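(* The complements $\mathbb{P}^2\setminus(L_+\cup\mathcal{C}_+)$ and $\mathbb{P}^2\setminus(L_-\cup\mathcal{C}_-)$ are analytically isomorphic (i.e. biholomorphic).
   Context: $\mathbb{P}^2$ is the complex projective plane with coordinates $[x:y:z]$. For $a\in\mathbb{C}$ with $a^2=3$, let $f_{2}(x,y,z)=(x-y)(z-y)+4(a+2)\,y\,(x-2y+z)$ and let $\mathcal{C}_a\subset\mathbb{P}^2$ be the sextic curve $$\mathcal{C}_a:\quad 48(26a+45)\,y^2(xz-y^2)^2-f_{2}(x,y,z)^3=0.$$ Put $\mathcal{C}_+:=\mathcal{C}_{\sqrt3}$ and $\mathcal{C}_-:=\mathcal{C}_{-\sqrt3}$. Each of these curves is an irreducible sextic whose singular points are two points of type $\mathbb{E}_6$, one point of type $\mathbb{A}_5$ and one point of type $\mathbb{A}_2$. $L_\pm$ denotes the tangent line to $\mathcal{C}_\pm$ at its $\mathbb{A}_5$-point $[1:1:1]$, namely $L_\pm: x-2y+z=0$. *)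

theory Defs
  imports "HOL-Analysis.Analysis"
begin

section \<open>The complex projective plane\<close>

definition proj_rel :: "complex^3 \<Rightarrow> complex^3 \<Rightarrow> bool" where
  "proj_rel v w \<longleftrightarrow> v \<noteq> 0 \<and> w \<noteq> 0 \<and> (\<exists>c. c \<noteq> 0 \<and> w = c *s v)"

quotient_type cp2 = "complex^3" / partial: proj_rel
  morphisms rep_cp2 proj
proof (rule part_equivpI)
  show "\<exists>v. proj_rel v v"
    by (rule exI[of _ "axis 1 1"]) (auto simp: proj_rel_def axis_eq_0_iff intro!: exI[of _ 1])
  show "symp proj_rel"
  proof (rule sympI)
    fix v w assume "proj_rel v w"
    then obtain c where c: "v \<noteq> 0" "w \<noteq> 0" "c \<noteq> 0" "w = c *s v"
      by (auto simp: proj_rel_def)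
    then have "v = inverse c *s w"
      by (simp add: vector_smult_assoc)
    with c show "proj_rel w v"
      unfolding proj_rel_def by (metis inverse_nonzero_iff_nonzero)
  qed
  show "transp proj_rel"
  proof (rule transpI)
    fix u v w assume "proj_rel u v" "proj_rel v w"
    then show "proj_rel u w"
      unfolding proj_rel_def by (metis mult_eq_0_iff vector_smult_assoc)
  qed
qed

text \<open>The quotient topology. The value of \<^const>\<open>proj\<close> at \<open>0\<close> is irrelevant
  and is excluded wherever \<^const>\<open>proj\<close> is used.\<close>

instantiation cp2 :: topological_space
begin

definition open_cp2 :: "cp2 set \<Rightarrow> bool" where
  "open_cp2 U \<longleftrightarrow> open {v. v \<noteq> 0 \<and> proj v \<in> U}"

instance
proof
  have "{v::complex^3. v \<noteq> 0 \<and> proj v \<in> UNIV} = - {0}"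
    by auto
  then show "open (UNIV :: cp2 set)"
    by (simp add: open_cp2_def open_Compl)
next
  fix S T :: "cp2 set"
  assume "open S" "open T"
  then have "open ({v. v \<noteq> 0 \<and> proj v \<in> S} \<inter> {v. v \<noteq> 0 \<and> proj v \<in> T})"
    by (auto simp: open_cp2_def)
  also have "{v. v \<noteq> 0 \<and> proj v \<in> S} \<inter> {v. v \<noteq> 0 \<and> proj v \<in> T}
      = {v. v \<noteq> 0 \<and> proj v \<in> S \<inter> T}"
    by auto
  finally show "open (S \<inter> T)"
    by (simp add: open_cp2_def)
next
  fix K :: "cp2 set set"
  assume "\<forall>S\<in>K. open S"
  then have "open (\<Union>S\<in>K. {v. v \<noteq> 0 \<and> proj v \<in> S})"
    by (auto simp: open_cp2_def)
  also have "(\<Union>S\<in>K. {v. v \<noteq> 0 \<and> proj v \<in> S}) = {v. v \<noteq> 0 \<and> proj v \<in> \<Union>K}"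
    by auto
  finally show "open (\<Union>K)"
    by (simp add: open_cp2_def)
qed

end

section \<open>The standard affine atlas\<close>

definition chart_domain :: "3 \<Rightarrow> cp2 set" where
  "chart_domain i = {proj v | v. v $ i \<noteq> 0}"

definition affine_coords :: "3 \<Rightarrow> complex^3 \<Rightarrow> complex^2" where
  "affine_coords i v =
    (if i = 1 then vector [v $ 2 / v $ 1, v $ 3 / v $ 1]
     else if i = 2 then vector [v $ 1 / v $ 2, v $ 3 / v $ 2]
     else vector [v $ 1 / v $ 3, v $ 2 / v $ 3])"

lift_definition chart :: "3 \<Rightarrow> cp2 \<Rightarrow> complex^2" is affine_coords
  by (auto simp: proj_rel_def affine_coords_def)

definition chart_inv :: "3 \<Rightarrow> complex^2 \<Rightarrow> cp2" where
  "chart_inv i w =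
    proj (if i = 1 then vector [1, w $ 1, w $ 2]
          else if i = 2 then vector [w $ 1, 1, w $ 2]
          else vector [w $ 1, w $ 2, 1])"

lemma proj_eq_iff:
  assumes "v \<noteq> 0" "w \<noteq> 0"
  shows "proj v = proj w \<longleftrightarrow> (\<exists>c. c \<noteq> 0 \<and> w = c *s v)"
proof -
  have r: "proj_rel u u" if "u \<noteq> 0" for u
    using that unfolding proj_rel_def by (metis one_neq_zero vector_smult_lid)
  have "proj_rel v w \<longleftrightarrow> proj v = proj w"
    using Quotient3_rel[OF Quotient3_cp2, of v w] r assms by auto
  then show ?thesis
    using assms by (auto simp: proj_rel_def)
qed

lemma proj_cases:
  obtains v where "v \<noteq> 0" "p = proj v"
proof -
  have "proj_rel (rep_cp2 p) (rep_cp2 p)" "proj (rep_cp2 p) = p"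
    using Quotient3_rep_reflp[OF Quotient3_cp2] Quotient3_abs_rep[OF Quotient3_cp2] by auto
  then show ?thesis
    using that unfolding proj_rel_def by metis
qed

lemma chart_proj:
  assumes "v \<noteq> 0"
  shows "chart i (proj v) = affine_coords i v"
proof -
  have "proj_rel v v"
    using assms unfolding proj_rel_def by (metis one_neq_zero vector_smult_lid)
  then show ?thesis
    by (rule chart.abs_eq)
qed

lemma chart_inv_in_domain: "chart_inv i w \<in> chart_domain i"
  using exhaust_3[of i] by (auto simp: chart_inv_def chart_domain_def)

lemma chart_chart_inv: "chart i (chart_inv i w) = w"
proof -
  have nz: "(vector [1, w $ 1, w $ 2] :: complex^3) \<noteq> 0"
    "(vector [w $ 1, 1, w $ 2] :: complex^3) \<noteq> 0" "(vector [w $ 1, w $ 2, 1] :: complex^3) \<noteq> 0"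
    by (auto simp: vec_eq_iff forall_3)
  show ?thesis
    using exhaust_3[of i]
    by (auto simp: chart_inv_def chart_proj[OF nz(1)] chart_proj[OF nz(2)] chart_proj[OF nz(3)]
        affine_coords_def vec_eq_iff forall_2)
qed

lemma chart_inv_chart:
  assumes "p \<in> chart_domain i"
  shows "chart_inv i (chart i p) = p"
proof -
  obtain v where v: "v $ i \<noteq> 0" "p = proj v"
    using assms by (auto simp: chart_domain_def)
  then have nz: "v \<noteq> 0"
    by auto
  define w where "w = inverse (v $ i) *s v"
  have w: "proj w = proj v"
    using v nz by (subst eq_commute, subst proj_eq_iff) (auto simp: w_def intro!: exI[of _ "inverse (v $ i)"])
  have "chart_inv i (affine_coords i v) = proj w"
    using exhaust_3[of i] v(1)
    by (auto simp: chart_inv_def affine_coords_def w_def field_simps vec_eq_iff forall_3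
        intro!: arg_cong[of _ _ proj])
  then show ?thesis
    using v nz w by (simp add: chart_proj)
qed

section \<open>Biholomorphic open subsets of the projective plane\<close>

definition complex_differentiable_at :: "(complex^2 \<Rightarrow> complex^2) \<Rightarrow> complex^2 \<Rightarrow> bool" where
  "complex_differentiable_at F w \<longleftrightarrow>
    (\<exists>D. (F has_derivative D) (at w) \<and> Vector_Spaces.linear (*s) (*s) D)"

text \<open>A map is holomorphic on an open set if it is continuous there and all its local
  expressions in the affine charts are complex differentiable wherever they are defined.
  Continuity makes the domains of these local expressions open, so that differentiability
  at each of their points does not depend on values of \<open>f\<close> outside \<open>U\<close>.\<close>

definition holomorphic_cp2_on :: "(cp2 \<Rightarrow> cp2) \<Rightarrow> cp2 set \<Rightarrow> bool" where
  "holomorphic_cp2_on f U \<longleftrightarrow>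
    open U \<and> continuous_on U f \<and>
    (\<forall>i j w. chart_inv i w \<in> U \<and> f (chart_inv i w) \<in> chart_domain j \<longrightarrow>
      complex_differentiable_at (chart j \<circ> f \<circ> chart_inv i) w)"

definition biholomorphic :: "cp2 set \<Rightarrow> cp2 set \<Rightarrow> bool" where
  "biholomorphic U V \<longleftrightarrow>
    (\<exists>f g. holomorphic_cp2_on f U \<and> holomorphic_cp2_on g V \<and>
      f ` U \<subseteq> V \<and> g ` V \<subseteq> U \<and>
      (\<forall>p\<in>U. g (f p) = p) \<and> (\<forall>q\<in>V. f (g q) = q))"

section \<open>The curves\<close>

text \<open>The zero locus of a homogeneous polynomial, given by its evaluation
  as a function of the coordinates \<open>x\<close>, \<open>y\<close>, \<open>z\<close>.\<close>

definition zero_locus :: "(complex \<Rightarrow> complex \<Rightarrow> complex \<Rightarrow> complex) \<Rightarrow> cp2 set" where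
  "zero_locus F = {proj v | v. v \<noteq> 0 \<and> F (v $ 1) (v $ 2) (v $ 3) = 0}"

definition f\<^sub>2 :: "complex \<Rightarrow> complex \<Rightarrow> complex \<Rightarrow> complex \<Rightarrow> complex" where
  "f\<^sub>2 a x y z = (x - y) * (z - y) + 4 * (a + 2) * y * (x - 2 * y + z)"

definition sextic :: "complex \<Rightarrow> cp2 set" where
  "sextic a = zero_locus (\<lambda>x y z.
     48 * (26 * a + 45) * y^2 * (x * z - y^2)^2 - (f\<^sub>2 a x y z)^3)"

definition C_plus :: "cp2 set" where
  "C_plus = sextic (complex_of_real (sqrt 3))"

definition C_minus :: "cp2 set" where
  "C_minus = sextic (- complex_of_real (sqrt 3))"

text \<open>The common tangent line of the two sextics at their \<open>A\<^sub>5\<close>-point \<open>[1:1:1]\<close>: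
  there \<open>f\<^sub>2\<close> vanishes, so the tangent cone is the double line given by the square of
  the linear part of \<open>x * z - y^2\<close>.\<close>

definition tangent_line :: "cp2 set" where
  "tangent_line = zero_locus (\<lambda>x y z. x - 2 * y + z)"

end

theory Submission
  imports Defs
begin

text \<open>Put \<open>X = x - y\<close>, \<open>Z = z - y\<close>, \<open>t = X + Z = x - 2 y + z\<close>, \<open>k = 4 (a + 2)\<close> and
  \<open>c a = 48 (26 a + 45)\<close>. Then \<open>x z - y\<^sup>2 = X Z + y t\<close> and \<open>f\<^sub>2 = X Z + k y t\<close>. On the affine
  plane \<open>t = 1\<close>, the complement of the tangent line, set \<open>w = X Z\<close>; the sextic becomes
  \<open>c a y\<^sup>2 (w + y)\<^sup>2 = (w + k y)\<^sup>3\<close>, which depends only on \<open>w\<close> and \<open>y\<close>. The polynomial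
  automorphism of the plane that fixes \<open>X\<close> and \<open>Z\<close>, hence \<open>w\<close>, and sends \<open>y\<close> to
  \<open>- (w + y)\<close> is an involution. Up to sign it exchanges the two factors \<open>y\<close> and \<open>w + y\<close> on the
  left, and it sends \<open>w + k' y\<close> to \<open>(1 - k') w - k' y\<close>. The latter is proportional to
  \<open>w + k y\<close> exactly when \<open>k k' = k + k'\<close>, and this holds for \<open>k' = 4 (2 - a)\<close> because
  \<open>a\<^sup>2 = 3\<close> makes both sides equal to 16. The constants match as well: \<open>c (- a) = (1 - k')\<^sup>3 c a\<close>.
  So the involution exchanges the two sextics.

  Homogenised, the involution is the quadratic map \<open>parabola_flip\<close> below, whose only base points
  lie on the line \<open>t = 0\<close>. The algebra is in \<open>parabola_flip_involution\<close> and
  \<open>sextic_form_parabola_flip\<close>. The rest is the passage from a homogeneous polynomial map to a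
  holomorphic map of open subsets of the projective plane.\<close>

section \<open>Complex differentiable scalar functions\<close>

text \<open>Scalar functions have closure rules under the field operations, so the quotients of
  polynomials that occur as local expressions are treated one coordinate at a time.\<close>

definition complex_differentiable_scalar_at :: "(complex^2 \<Rightarrow> complex) \<Rightarrow> complex^2 \<Rightarrow> bool" where
  "complex_differentiable_scalar_at h w \<longleftrightarrow>
    (\<exists>D. (h has_derivative D) (at w) \<and> (\<forall>c v. D (c *s v) = c * D v))"

lemma complex_differentiable_scalar_at_const:
  "complex_differentiable_scalar_at (\<lambda>w. c) w"
  unfolding complex_differentiable_scalar_at_def
  by (rule exI[of _ "\<lambda>v. 0"]) simp

lemma complex_differentiable_scalar_at_component:
  "complex_differentiable_scalar_at (\<lambda>w. w $ k) w"
  unfolding complex_differentiable_scalar_at_def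
  by (rule exI[of _ "\<lambda>v. v $ k"])
     (auto intro!: bounded_linear_imp_has_derivative bounded_linear_vec_nth)

lemma complex_differentiable_scalar_at_add:
  assumes "complex_differentiable_scalar_at g w" "complex_differentiable_scalar_at h w"
  shows "complex_differentiable_scalar_at (\<lambda>w. g w + h w) w"
proof -
  obtain D E where D: "(g has_derivative D) (at w)" "\<And>c v. D (c *s v) = c * D v"
    and E: "(h has_derivative E) (at w)" "\<And>c v. E (c *s v) = c * E v"
    using assms unfolding complex_differentiable_scalar_at_def by blast
  show ?thesis
    unfolding complex_differentiable_scalar_at_def
    by (intro exI[of _ "\<lambda>v. D v + E v"] conjI has_derivative_add D(1) E(1))
       (simp add: D(2) E(2) algebra_simps)
qed

lemma complex_differentiable_scalar_at_mult:
  assumes "complex_differentiable_scalar_at g w" "complex_differentiable_scalar_at h w"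
  shows "complex_differentiable_scalar_at (\<lambda>w. g w * h w) w"
proof -
  obtain D E where D: "(g has_derivative D) (at w)" "\<And>c v. D (c *s v) = c * D v"
    and E: "(h has_derivative E) (at w)" "\<And>c v. E (c *s v) = c * E v"
    using assms unfolding complex_differentiable_scalar_at_def by blast
  show ?thesis
    unfolding complex_differentiable_scalar_at_def
    by (intro exI[of _ "\<lambda>v. g w * E v + D v * h w"] conjI has_derivative_mult D(1) E(1))
       (simp add: D(2) E(2) algebra_simps)
qed

lemma complex_differentiable_scalar_at_diff:
  assumes "complex_differentiable_scalar_at g w" "complex_differentiable_scalar_at h w"
  shows "complex_differentiable_scalar_at (\<lambda>w. g w - h w) w"
proof -
  obtain D E where D: "(g has_derivative D) (at w)" "\<And>c v. D (c *s v) = c * D v"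
    and E: "(h has_derivative E) (at w)" "\<And>c v. E (c *s v) = c * E v"
    using assms unfolding complex_differentiable_scalar_at_def by blast
  show ?thesis
    unfolding complex_differentiable_scalar_at_def
    by (intro exI[of _ "\<lambda>v. D v - E v"] conjI has_derivative_diff D(1) E(1))
       (simp add: D(2) E(2) algebra_simps)
qed

lemma complex_differentiable_scalar_at_divide:
  assumes "complex_differentiable_scalar_at g w" "complex_differentiable_scalar_at h w" "h w \<noteq> 0"
  shows "complex_differentiable_scalar_at (\<lambda>w. g w / h w) w"
proof -
  obtain D E where D: "(g has_derivative D) (at w)" "\<And>c v. D (c *s v) = c * D v"
    and E: "(h has_derivative E) (at w)" "\<And>c v. E (c *s v) = c * E v"
    using assms unfolding complex_differentiable_scalar_at_def by blast
  show ?thesis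
    unfolding complex_differentiable_scalar_at_def
    by (intro exI[of _ "\<lambda>v. (D v * h w - g w * E v) / (h w * h w)"] conjI
        has_derivative_divide' D(1) E(1) \<open>h w \<noteq> 0\<close>)
       (simp add: D(2) E(2) algebra_simps)
qed

lemma complex_differentiable_at_vector:
  assumes "complex_differentiable_scalar_at g w" "complex_differentiable_scalar_at h w"
  shows "complex_differentiable_at (\<lambda>w. vector [g w, h w]) w"
proof -
  obtain D E where D: "(g has_derivative D) (at w)" "\<And>c v. D (c *s v) = c * D v"
    and E: "(h has_derivative E) (at w)" "\<And>c v. E (c *s v) = c * E v"
    using assms unfolding complex_differentiable_scalar_at_def by blast
  have add: "D (u + v) = D u + D v" "E (u + v) = E u + E v" for u v
    using D(1) E(1) by (simp_all add: has_derivative_def bounded_linear.linear linear_add)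
  have vector_eq: "vector [p, q] = axis 1 p + (axis 2 q :: complex^2)" for p q
    by (simp add: vec_eq_iff forall_2 axis_def)
  have axis: "bounded_linear (axis k :: complex \<Rightarrow> complex^2)" for k
    by (auto simp: linear_conv_bounded_linear[symmetric] vec_eq_iff axis_def intro!: linearI)
  have "((\<lambda>w. vector [g w, h w] :: complex^2) has_derivative (\<lambda>v. vector [D v, E v])) (at w)"
    unfolding vector_eq
    by (intro has_derivative_add bounded_linear.has_derivative[OF axis] D(1) E(1))
  moreover have "Vector_Spaces.linear (*s) (*s) (\<lambda>v. vector [D v, E v] :: complex^2)"
    by unfold_locales (simp_all add: add D(2) E(2) vec_eq_iff forall_2 algebra_simps)
  ultimately show ?thesis
    unfolding complex_differentiable_at_def by blast
qed

section \<open>Homogeneous coordinates\<close>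

lemma proj_mem_zero_locus_iff:
  assumes hom: "\<And>c x y z. F (c * x) (c * y) (c * z) = c ^ d * F x y z" and "v \<noteq> 0"
  shows "proj v \<in> zero_locus F \<longleftrightarrow> F (v $ 1) (v $ 2) (v $ 3) = 0"
  using \<open>v \<noteq> 0\<close> hom by (auto simp: zero_locus_def proj_eq_iff)

lemma proj_mem_chart_domain_iff:
  assumes "v \<noteq> 0"
  shows "proj v \<in> chart_domain j \<longleftrightarrow> v $ j \<noteq> 0"
proof
  assume "proj v \<in> chart_domain j"
  then obtain u where u: "proj v = proj u" "u $ j \<noteq> 0"
    by (auto simp: chart_domain_def)
  then have "u \<noteq> 0" by auto
  with u assms show "v $ j \<noteq> 0"
    by (auto simp: proj_eq_iff)
qed (auto simp: chart_domain_def)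

lemma proj_rep_cp2 [simp]: "proj (rep_cp2 p) = p"
  using Quotient3_abs_rep[OF Quotient3_cp2] by simp

lemma rep_cp2_nonzero [simp]: "rep_cp2 p \<noteq> 0"
  using Quotient3_rep_reflp[OF Quotient3_cp2, of p] by (simp add: proj_rel_def)

definition affine_lift :: "3 \<Rightarrow> complex^2 \<Rightarrow> complex^3" where
  "affine_lift i w =
    (if i = 1 then vector [1, w $ 1, w $ 2]
     else if i = 2 then vector [w $ 1, 1, w $ 2] else vector [w $ 1, w $ 2, 1])"

lemma chart_inv_eq: "chart_inv i w = proj (affine_lift i w)"
  by (simp add: chart_inv_def affine_lift_def)

lemma affine_lift_nonzero [simp]: "affine_lift i w \<noteq> 0"
  by (auto simp: affine_lift_def vec_eq_iff forall_3)

lemma complex_differentiable_scalar_at_affine_lift: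
  "complex_differentiable_scalar_at (\<lambda>w. affine_lift i w $ k) w"
  using exhaust_3[of i] exhaust_3[of k]
  by (elim disjE; simp add: affine_lift_def; intro complex_differentiable_scalar_at_const
      complex_differentiable_scalar_at_component)

lemma continuous_on_affine_lift: "continuous_on S (\<lambda>w. affine_lift i w $ k)"
  using exhaust_3[of i] exhaust_3[of k]
  by (elim disjE; simp add: affine_lift_def; intro continuous_on_const continuous_on_component continuous_on_id)

lemma complex_differentiable_at_affine_coords:
  assumes "\<And>k. complex_differentiable_scalar_at (\<lambda>w. h w $ k) w" and "h w $ j \<noteq> 0"
  shows "complex_differentiable_at (\<lambda>w. affine_coords j (h w)) w"
proof -
  have "complex_differentiable_scalar_at (\<lambda>w. h w $ k / h w $ j) w" for k
    by (rule complex_differentiable_scalar_at_divide[OF assms(1) assms(1) assms(2)])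
  then show ?thesis
    using exhaust_3[of j]
    by (elim disjE; simp add: affine_coords_def; intro complex_differentiable_at_vector; simp)
qed

section \<open>The involution of the complement of the tangent line\<close>

definition tangent_form :: "complex^3 \<Rightarrow> complex" where
  "tangent_form v = v $ 1 - 2 * v $ 2 + v $ 3"

definition sextic_form :: "complex \<Rightarrow> complex^3 \<Rightarrow> complex" where
  "sextic_form a v =
    48 * (26 * a + 45) * (v $ 2)^2 * (v $ 1 * v $ 3 - (v $ 2)^2)^2 - (f\<^sub>2 a (v $ 1) (v $ 2) (v $ 3))^3"

text \<open>The homogenisation of \<open>(X, Z, y) \<mapsto> (X, Z, - (X Z + y))\<close>, in the coordinates
  \<open>x = X + y\<close> and \<open>z = Z + y\<close>. It exchanges the line \<open>y = 0\<close> with the conic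
  \<open>x z = y\<^sup>2\<close>, which is a parabola in the affine plane.\<close>

definition parabola_flip :: "complex^3 \<Rightarrow> complex^3" where
  "parabola_flip v = (let t = tangent_form v; q = v $ 1 * v $ 3 - (v $ 2)^2
    in vector [(v $ 1 - v $ 2) * t - q, - q, (v $ 3 - v $ 2) * t - q])"

definition parabola_flip_cp2 :: "cp2 \<Rightarrow> cp2" where
  "parabola_flip_cp2 p = proj (parabola_flip (rep_cp2 p))"

lemma parabola_flip_nth [simp]:
  "parabola_flip v $ 1 = (v $ 1 - v $ 2) * tangent_form v - (v $ 1 * v $ 3 - (v $ 2)^2)"
  "parabola_flip v $ 2 = - (v $ 1 * v $ 3 - (v $ 2)^2)"
  "parabola_flip v $ 3 = (v $ 3 - v $ 2) * tangent_form v - (v $ 1 * v $ 3 - (v $ 2)^2)"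
  by (simp_all add: parabola_flip_def Let_def)

lemma parabola_flip_scale: "parabola_flip (c *s v) = c^2 *s parabola_flip v"
  by (simp add: vec_eq_iff forall_3 tangent_form_def power2_eq_square algebra_simps)

lemma tangent_form_parabola_flip: "tangent_form (parabola_flip v) = (tangent_form v)^2"
  by (simp add: tangent_form_def power2_eq_square algebra_simps)

text \<open>At \<open>t = 1\<close> this says that the new \<open>w + y\<close> is \<open>- y\<close>. Together with the second
  coordinate of \<^const>\<open>parabola_flip\<close>, which says that the new \<open>y\<close> is \<open>- (w + y)\<close>, it carries
  both the involution property and the transformation of the sextics.\<close>

lemma conic_parabola_flip:
  "parabola_flip v $ 1 * parabola_flip v $ 3 - (parabola_flip v $ 2)^2 = - (v $ 2 * (tangent_form v)^3)"
proof -
  define X Z y t where "X = v $ 1 - v $ 2" and "Z = v $ 3 - v $ 2" and "y = v $ 2"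
    and "t = tangent_form v"
  have t: "t = X + Z" and q: "v $ 1 * v $ 3 - (v $ 2)^2 = X * Z + y * t"
    by (simp_all add: X_def Z_def y_def t_def tangent_form_def power2_eq_square algebra_simps)
  have "(X * t - (X * Z + y * t)) * (Z * t - (X * Z + y * t)) - (- (X * Z + y * t))^2
      = X * Z * t^2 - (X * Z + y * t) * ((X + Z) * t)"
    by (simp add: power2_eq_square algebra_simps)
  also have "\<dots> = - (y * t^3)"
    by (simp add: t[symmetric] power2_eq_square power3_eq_cube algebra_simps)
  finally show ?thesis
    unfolding parabola_flip_nth q by (simp only: X_def Z_def y_def t_def)
qed

lemma parabola_flip_involution: "parabola_flip (parabola_flip v) = (tangent_form v)^3 *s v"
proof -
  have "parabola_flip v $ 1 - parabola_flip v $ 2 = (v $ 1 - v $ 2) * tangent_form v"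
    "parabola_flip v $ 3 - parabola_flip v $ 2 = (v $ 3 - v $ 2) * tangent_form v"
    by simp_all
  then show ?thesis
    unfolding vec_eq_iff forall_3 parabola_flip_nth(1-3)[of "parabola_flip v"]
      conic_parabola_flip tangent_form_parabola_flip
    by (simp add: power2_eq_square power3_eq_cube algebra_simps)
qed

lemma f\<^sub>2_eq: "f\<^sub>2 a (v $ 1) (v $ 2) (v $ 3)
    = (v $ 1 - v $ 2) * (v $ 3 - v $ 2) + 4 * (a + 2) * (v $ 2 * tangent_form v)"
  by (simp add: f\<^sub>2_def tangent_form_def algebra_simps)

text \<open>With \<open>k' = 4 (2 - a)\<close> the factor \<open>4 a - 7\<close> is \<open>1 - k'\<close>: the coefficient comes from
  rewriting \<open>(1 - k') w - k' y\<close> as a multiple of \<open>w + k y\<close>.\<close>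

lemma sextic_form_parabola_flip:
  assumes "a^2 = 3"
  shows "sextic_form (- a) (parabola_flip v) = (4 * a - 7)^3 * (tangent_form v)^6 * sextic_form a v"
proof -
  define p y t q where "p = (v $ 1 - v $ 2) * (v $ 3 - v $ 2)" and "y = v $ 2"
    and "t = tangent_form v" and "q = v $ 1 * v $ 3 - (v $ 2)^2"
  have q: "q = p + y * t"
    by (simp add: p_def y_def q_def t_def tangent_form_def power2_eq_square algebra_simps)
  have aa: "a * a = 3"
    using assms by (simp add: power2_eq_square)
  \<comment> \<open>This is \<open>(1 - k') k = - k'\<close>.\<close>
  have coeff: "(4 * a - 7) * (4 * a + 8) = 4 * a - 8"
    using aa by (simp add: algebra_simps)
  have "f\<^sub>2 (- a) (parabola_flip v $ 1) (parabola_flip v $ 2) (parabola_flip v $ 3)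
      = t^2 * (p - (8 - 4 * a) * (p + y * t))"
    unfolding f\<^sub>2_eq tangent_form_parabola_flip q[symmetric]
    by (simp add: p_def t_def q_def power2_eq_square algebra_simps)
  also have "\<dots> = t^2 * ((4 * a - 7) * p + (4 * a - 8) * (y * t))"
    by (simp add: algebra_simps)
  also have "\<dots> = t^2 * ((4 * a - 7) * (p + (4 * a + 8) * (y * t)))"
    by (subst coeff[symmetric]) (simp only: distrib_left[of "4 * a - 7" p] mult.assoc)
  also have "\<dots> = (4 * a - 7) * t^2 * f\<^sub>2 a (v $ 1) (v $ 2) (v $ 3)"
    by (simp add: f\<^sub>2_eq p_def y_def t_def algebra_simps)
  finally have f2: "f\<^sub>2 (- a) (parabola_flip v $ 1) (parabola_flip v $ 2) (parabola_flip v $ 3)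
      = (4 * a - 7) * t^2 * f\<^sub>2 a (v $ 1) (v $ 2) (v $ 3)" .
  have const: "48 * (26 * (- a) + 45) = (4 * a - 7)^3 * (48 * (26 * a + 45))"
  proof -
    have square: "(4 * a - 7) * (4 * a - 7) = 97 - 56 * a"
      using aa by (simp add: algebra_simps)
    have cube: "(4 * a - 7)^3 = 780 * a - 1351"
      unfolding power3_eq_cube square using aa by (simp add: algebra_simps)
    show ?thesis
      unfolding cube using aa by (simp add: algebra_simps)
  qed
  have flip_y: "parabola_flip v $ 2 = - q"
    by (simp add: q_def)
  have factor: "k^3 * K * (- q)^2 * (- (y * t^3))^2 - (k * t^2 * f)^3
      = k^3 * t^6 * (K * y^2 * q^2 - f^3)" for k K f :: complex
    by (simp add: eval_nat_numeral algebra_simps)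
  have "sextic_form (- a) (parabola_flip v)
      = 48 * (26 * (- a) + 45) * (- q)^2 * (- (y * t^3))^2
        - ((4 * a - 7) * t^2 * f\<^sub>2 a (v $ 1) (v $ 2) (v $ 3))^3"
    unfolding sextic_form_def conic_parabola_flip f2 unfolding flip_y y_def t_def ..
  also have "\<dots> = (4 * a - 7)^3 * t^6
      * (48 * (26 * a + 45) * y^2 * q^2 - (f\<^sub>2 a (v $ 1) (v $ 2) (v $ 3))^3)"
    unfolding const by (rule factor)
  finally show ?thesis
    by (simp add: sextic_form_def y_def t_def q_def)
qed

lemma parabola_flip_nonzero:
  assumes "tangent_form v \<noteq> 0"
  shows "parabola_flip v \<noteq> 0"
proof
  assume "parabola_flip v = 0"
  with tangent_form_parabola_flip[of v] assms show False
    by (simp add: tangent_form_def)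
qed

lemma parabola_flip_cp2_proj:
  assumes "tangent_form v \<noteq> 0"
  shows "parabola_flip_cp2 (proj v) = proj (parabola_flip v)"
proof -
  have v: "v \<noteq> 0"
    using assms by (auto simp: tangent_form_def)
  have "proj v = proj (rep_cp2 (proj v))"
    by simp
  then obtain c where c: "c \<noteq> 0" "rep_cp2 (proj v) = c *s v"
    using v by (subst (asm) proj_eq_iff) auto
  have "proj (parabola_flip v) = proj (c^2 *s parabola_flip v)"
    using c(1) parabola_flip_nonzero[OF assms]
    by (subst proj_eq_iff) (auto intro!: exI[of _ "c^2"])
  then show ?thesis
    by (simp add: parabola_flip_cp2_def c(2) parabola_flip_scale)
qed

lemma continuous_on_parabola_flip: "continuous_on S parabola_flip"
proof -
  have "continuous_on S (\<lambda>v. parabola_flip v $ k)" for k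
    using exhaust_3[of k]
    by (elim disjE; simp add: tangent_form_def; intro continuous_intros)
  then have "continuous_on S (\<lambda>v. \<chi> k. parabola_flip v $ k)"
    by (rule continuous_on_vec_lambda)
  then show ?thesis
    by simp
qed

lemma complex_differentiable_scalar_at_parabola_flip:
  "complex_differentiable_scalar_at (\<lambda>w. parabola_flip (affine_lift i w) $ k) w"
proof -
  have neg: "- (p - q) = q - p" for p q :: complex
    by simp
  show ?thesis
    using exhaust_3[of k]
    by (elim disjE; simp add: tangent_form_def power2_eq_square neg del: minus_diff_eq;
        intro complex_differentiable_scalar_at_const complex_differentiable_scalar_at_affine_lift
          complex_differentiable_scalar_at_add complex_differentiable_scalar_at_diff
          complex_differentiable_scalar_at_mult)
qed

text \<open>Since \<^const>\<open>parabola_flip\<close> has no zeros off the tangent line, it defines a holomorphic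
  map on every open set that avoids this line.\<close>

lemma holomorphic_parabola_flip_cp2:
  assumes "open U" and "\<And>v. v \<noteq> 0 \<Longrightarrow> proj v \<in> U \<Longrightarrow> tangent_form v \<noteq> 0"
  shows "holomorphic_cp2_on parabola_flip_cp2 U"
  unfolding holomorphic_cp2_on_def
proof (intro conjI allI impI)
  show "open U" by fact
next
  show "continuous_on U parabola_flip_cp2"
    unfolding continuous_on_open_vimage[OF \<open>open U\<close>]
  proof (intro allI impI)
    fix B :: "cp2 set" assume "open B"
    let ?cone = "\<lambda>S. {v. v \<noteq> 0 \<and> proj v \<in> S}"
    have "open (?cone U)" "open (?cone B)"
      using \<open>open U\<close> \<open>open B\<close> by (auto simp: open_cp2_def)
    then have "open (parabola_flip -` ?cone B \<inter> ?cone U)"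
      using continuous_on_parabola_flip continuous_on_open_vimage by blast
    also have "parabola_flip -` ?cone B \<inter> ?cone U = ?cone (parabola_flip_cp2 -` B \<inter> U)"
      using assms(2) by (auto simp: parabola_flip_cp2_proj parabola_flip_nonzero)
    finally show "open (parabola_flip_cp2 -` B \<inter> U)"
      by (simp add: open_cp2_def)
  qed
next
  fix i j w
  assume w: "chart_inv i w \<in> U \<and> parabola_flip_cp2 (chart_inv i w) \<in> chart_domain j"
  define S where "S = {w. tangent_form (affine_lift i w) \<noteq> 0}"
  have "w \<in> S"
    using w assms(2) by (auto simp: S_def chart_inv_eq)
  have "continuous_on UNIV (\<lambda>w. tangent_form (affine_lift i w))"
    unfolding tangent_form_def by (intro continuous_intros continuous_on_affine_lift)
  then have "open S"
    unfolding S_def by (intro open_Collect_neq) auto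
  have local_expr: "affine_coords j (parabola_flip (affine_lift i u))
      = (chart j \<circ> parabola_flip_cp2 \<circ> chart_inv i) u" if "u \<in> S" for u
    using that
    by (simp add: S_def chart_inv_eq parabola_flip_cp2_proj chart_proj parabola_flip_nonzero)
  have "parabola_flip (affine_lift i w) $ j \<noteq> 0"
    using w \<open>w \<in> S\<close>
    by (simp add: S_def chart_inv_eq parabola_flip_cp2_proj proj_mem_chart_domain_iff
        parabola_flip_nonzero)
  then have "complex_differentiable_at (\<lambda>u. affine_coords j (parabola_flip (affine_lift i u))) w"
    by (intro complex_differentiable_at_affine_coords complex_differentiable_scalar_at_parabola_flip)
  then show "complex_differentiable_at (chart j \<circ> parabola_flip_cp2 \<circ> chart_inv i) w"
    unfolding complex_differentiable_at_def
    using has_derivative_transform_within_open \<open>open S\<close> \<open>w \<in> S\<close> local_expr by blast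
qed

section \<open>The complements of the two sextics\<close>

lemma proj_mem_complement_iff:
  assumes "v \<noteq> 0"
  shows "proj v \<in> - (tangent_line \<union> sextic a) \<longleftrightarrow> tangent_form v \<noteq> 0 \<and> sextic_form a v \<noteq> 0"
proof -
  have line: "proj v \<in> tangent_line \<longleftrightarrow> tangent_form v = 0"
    unfolding tangent_line_def tangent_form_def
    by (rule proj_mem_zero_locus_iff[where d = 1]) (use assms in \<open>auto simp: algebra_simps\<close>)
  have sextic_hom: "48 * (26 * a + 45) * (c * y)^2 * (c * x * (c * z) - (c * y)^2)^2
      - (f\<^sub>2 a (c * x) (c * y) (c * z))^3
      = c^6 * (48 * (26 * a + 45) * y^2 * (x * z - y^2)^2 - (f\<^sub>2 a x y z)^3)" for c x y z
  proof -
    have quadratic: "c * x * (c * z) - (c * y)^2 = c^2 * (x * z - y^2)"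
      "f\<^sub>2 a (c * x) (c * y) (c * z) = c^2 * f\<^sub>2 a x y z"
      by (simp_all add: f\<^sub>2_def power2_eq_square algebra_simps)
    have factor: "K * (c * y)^2 * (c^2 * q)^2 - (c^2 * f)^3 = c^6 * (K * y^2 * q^2 - f^3)" for K q f
      by (simp add: eval_nat_numeral algebra_simps)
    show ?thesis
      unfolding quadratic by (rule factor)
  qed
  have "proj v \<in> sextic a \<longleftrightarrow> sextic_form a v = 0"
    unfolding sextic_def sextic_form_def
    by (rule proj_mem_zero_locus_iff[where d = 6]) (fact sextic_hom assms)+
  with line show ?thesis
    by simp
qed

lemma open_complement: "open (- (tangent_line \<union> sextic a))"
proof -
  have "{v. v \<noteq> 0 \<and> proj v \<in> - (tangent_line \<union> sextic a)}
      = {v. v \<noteq> 0} \<inter> {v. tangent_form v \<noteq> 0} \<inter> {v. sextic_form a v \<noteq> 0}"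
    using proj_mem_complement_iff by auto
  also have "open \<dots>"
    unfolding tangent_form_def sextic_form_def f\<^sub>2_def
    by (intro open_Int open_Collect_neq continuous_intros)
  finally show ?thesis
    by (simp add: open_cp2_def)
qed

lemma holomorphic_on_complement:
  "holomorphic_cp2_on parabola_flip_cp2 (- (tangent_line \<union> sextic a))"
  by (rule holomorphic_parabola_flip_cp2[OF open_complement]) (use proj_mem_complement_iff in blast)

lemma parabola_flip_cp2_mem_complement:
  assumes "a^2 = 3" and "p \<in> - (tangent_line \<union> sextic a)"
  shows "parabola_flip_cp2 p \<in> - (tangent_line \<union> sextic (- a))"
proof -
  obtain v where v: "v \<noteq> 0" "p = proj v"
    by (rule proj_cases)
  then have nz: "tangent_form v \<noteq> 0" "sextic_form a v \<noteq> 0"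
    using assms(2) proj_mem_complement_iff by blast+
  \<comment> \<open>\<open>4 a - 7\<close> is a unit because its norm \<open>16 a\<^sup>2 - 49\<close> is \<open>- 1\<close>.\<close>
  have "(4 * a - 7) * (4 * a + 7) = - 1"
    using assms(1) by (simp add: power2_eq_square algebra_simps)
  then have "4 * a - 7 \<noteq> 0"
    by auto
  then have "tangent_form (parabola_flip v) \<noteq> 0" "sextic_form (- a) (parabola_flip v) \<noteq> 0"
    using nz by (simp_all add: tangent_form_parabola_flip sextic_form_parabola_flip[OF assms(1)])
  then show ?thesis
    using nz(1) v(2) parabola_flip_cp2_proj parabola_flip_nonzero proj_mem_complement_iff by metis
qed

lemma parabola_flip_cp2_involution:
  assumes "p \<in> - (tangent_line \<union> sextic a)"
  shows "parabola_flip_cp2 (parabola_flip_cp2 p) = p"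
proof -
  obtain v where v: "v \<noteq> 0" "p = proj v"
    by (rule proj_cases)
  then have nz: "tangent_form v \<noteq> 0"
    using assms proj_mem_complement_iff by blast
  then have "parabola_flip_cp2 (parabola_flip_cp2 p) = proj ((tangent_form v)^3 *s v)"
    by (simp add: v(2) parabola_flip_cp2_proj tangent_form_parabola_flip parabola_flip_involution)
  also have "\<dots> = proj v"
    using v(1) nz
    by (subst eq_commute, subst proj_eq_iff) (auto intro!: exI[of _ "(tangent_form v)^3"])
  finally show ?thesis
    using v(2) by simp
qed

theorem theorem1p10:
  shows "biholomorphic (- (tangent_line \<union> C_plus)) (- (tangent_line \<union> C_minus))"
proof -
  define a where "a = complex_of_real (sqrt 3)"
  have sq: "a^2 = 3" "(- a)^2 = 3"
    by (simp_all add: a_def flip: of_real_power)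
  have "parabola_flip_cp2 p \<in> - (tangent_line \<union> sextic (- a))"
    if "p \<in> - (tangent_line \<union> sextic a)" for p
    using that by (rule parabola_flip_cp2_mem_complement[OF sq(1)])
  moreover have "parabola_flip_cp2 p \<in> - (tangent_line \<union> sextic a)"
    if "p \<in> - (tangent_line \<union> sextic (- a))" for p
    using parabola_flip_cp2_mem_complement[OF sq(2) that] by simp
  ultimately show ?thesis
    unfolding biholomorphic_def C_plus_def C_minus_def a_def[symmetric]
    using holomorphic_on_complement parabola_flip_cp2_involution
    by (intro exI[of _ parabola_flip_cp2]) blast
qed

end
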